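(* Let $n\ge1$ and $x,y\in\mathfrak{S}_n$. If $x\geq_B y$ and $x$ is an AR permutation, then $x\unrhd_R y$.
   Context: Notation: $[m,n]=\{m,\dots,n\}$, $[n]=[1,n]$. For $a,b\in\mathbb{Z}^n$, $a\leq_C b$ means $a(i)\leq b(i)$ for all $i$. For $x\in[n]^n$ the conjugate is $x^*=(n+1-x(n),\dots,n+1-x(1))$. $\mathfrak{S}_n$ is the group of permutations of $[n]$. Parking functions: cars $1,\dots,n$ enter, in this order, a one-way street with spots $1,\dots,n$. Given $a\in[n]^n$, car $i$ parks in the first (lowest-numbered) available spot in $[a(i),n]$; if there is none, the procedure fails. If all cars park, $a$ is a parking function, and its outcome is the permutation $\mathcal{O}(a)=w\in\mathfrak{S}_n$, where car $i$ parks in spot $w(i)$. Interval parking functions (IPFs): given $a,b\in[n]^n$ with $a\leq_C b$, car $i$ parks in the first available spot in $[a(i),b(i)]$; if there is none, the procedure fails. If all cars park, $(a,b)$ is an interval parking function. If $(a,b)$ is an IPF, then both $a$ and $b^*$ are parking functions. Reachability: $x\unrhd_R y$ means there exists an IPF $(a,b)$ with $x=\mathcal{O}(a)$ and $y=\mathcal{O}(b^* )^*$. Bruhat order $\geq_B$ on $\mathfrak{S}_n$: the partial order generated by (reflexive-transitive closure of) the relations $x>t_{ij}x$ whenever $\ell(x)>\ell(t_{ij}x)$, where $t_{ij}$ is the transposition of $i$ and $j$, products are composed right to left, and $\ell(x)$ is the number of pairs $i<j$ with $x(i)>x(j)$. AR permutation: $x\in\mathfrak{S}_n$ is an AR permutation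 if $x^{-1}(i)\leq i+1$ for all $i\in[n]$; equivalently, if $\#\{k\in[j]: x(k)\geq j\}=1$ for all $j\in[n]$; equivalently, if $x$ avoids both patterns $231$ and $321$; equivalently, if $x=s_{i_1}\cdots s_{i_k}$ for some $n-1\geq i_1>\cdots>i_k\geq1$, where $s_i$ is the transposition of $i$ and $i+1$. *)

theory Defs
  imports "HOL-Combinatorics.Permutations" "HOL-Library.FuncSet"
begin

text \<open>
  An element of \<open>[n]\<^sup>n\<close> is a function \<open>a \<in> {1..n} \<rightarrow> {1..n}\<close> whose values outside \<open>{1..n}\<close> are
  irrelevant. An element of the symmetric group is a function \<open>x\<close> with \<open>x permutes {1..n}\<close>,
  hence the identity outside \<open>{1..n}\<close>; outcomes and conjugates below respect this convention.
\<close>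

definition conjugate :: "nat \<Rightarrow> (nat \<Rightarrow> nat) \<Rightarrow> nat \<Rightarrow> nat" where
  "conjugate n x = (\<lambda>i. if i \<in> {1..n} then n + 1 - x (n + 1 - i) else i)"

text \<open>
  \<open>park a b m\<close> is the result of parking the cars \<open>1, \<dots>, m\<close> in this order, where car \<open>i\<close> takes the
  first free spot in \<open>[a i, b i]\<close>. It is \<open>None\<close> on failure, and otherwise \<open>Some w\<close> with car \<open>i\<close>
  in spot \<open>w i\<close> for \<open>i \<in> {1..m}\<close>; elsewhere \<open>w\<close> is the identity, which has no meaning for the
  cars that have not parked yet.
\<close>

primrec park :: "(nat \<Rightarrow> nat) \<Rightarrow> (nat \<Rightarrow> nat) \<Rightarrow> nat \<Rightarrow> (nat \<Rightarrow> nat) option" where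
  "park a b 0 = Some id"
| "park a b (Suc m) =
     (case park a b m of
        None \<Rightarrow> None
      | Some w \<Rightarrow>
          (let free = {a (Suc m)..b (Suc m)} - w ` {1..m}
           in if free = {} then None else Some (w(Suc m := Min free))))"

definition interval_parking_function :: "nat \<Rightarrow> (nat \<Rightarrow> nat) \<Rightarrow> (nat \<Rightarrow> nat) \<Rightarrow> bool" where
  "interval_parking_function n a b \<longleftrightarrow>
     a \<in> {1..n} \<rightarrow> {1..n} \<and> b \<in> {1..n} \<rightarrow> {1..n} \<and> (\<forall>i\<in>{1..n}. a i \<le> b i) \<and>
     park a b n \<noteq> None"

text \<open>The outcome is \<open>None\<close> exactly when \<open>a\<close> is not a parking function.\<close>

definition outcome :: "nat \<Rightarrow> (nat \<Rightarrow> nat) \<Rightarrow> (nat \<Rightarrow> nat) option" where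
  "outcome n a = (if a \<in> {1..n} \<rightarrow> {1..n} then park a (\<lambda>_. n) n else None)"

text \<open>
  If \<open>(a, b)\<close> is an interval parking function, then \<open>a\<close> and \<open>conjugate n b\<close> are parking functions,
  so the demand below that both outcomes exist does not restrict the choice of \<open>a\<close> and \<open>b\<close>.
\<close>

definition reaches :: "nat \<Rightarrow> (nat \<Rightarrow> nat) \<Rightarrow> (nat \<Rightarrow> nat) \<Rightarrow> bool" where
  "reaches n x y \<longleftrightarrow>
     (\<exists>a b. interval_parking_function n a b \<and>
        outcome n a = Some x \<and>
        map_option (conjugate n) (outcome n (conjugate n b)) = Some y)"

definition perm_length :: "nat \<Rightarrow> (nat \<Rightarrow> nat) \<Rightarrow> nat" where
  "perm_length n x = card {(i, j). i \<in> {1..n} \<and> j \<in> {1..n} \<and> i < j \<and> x i > x j}"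

definition bruhat_step :: "nat \<Rightarrow> (nat \<Rightarrow> nat) \<Rightarrow> (nat \<Rightarrow> nat) \<Rightarrow> bool" where
  "bruhat_step n x y \<longleftrightarrow>
     (\<exists>i\<in>{1..n}. \<exists>j\<in>{1..n}. y = transpose i j \<circ> x \<and> perm_length n x > perm_length n y)"

definition bruhat_ge :: "nat \<Rightarrow> (nat \<Rightarrow> nat) \<Rightarrow> (nat \<Rightarrow> nat) \<Rightarrow> bool" where
  "bruhat_ge n = (bruhat_step n)\<^sup>*\<^sup>*"

definition AR_permutation :: "nat \<Rightarrow> (nat \<Rightarrow> nat) \<Rightarrow> bool" where
  "AR_permutation n x \<longleftrightarrow> x permutes {1..n} \<and> (\<forall>i\<in>{1..n}. inv x i \<le> i + 1)"

end

theory Submission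
  imports Defs
begin

text \<open>
  Run backwards, the parking of \<open>conjugate n b\<close> lets the cars \<open>n, \<dots>, 1\<close> drive in this order
  towards lower spots, car \<open>i\<close> taking the highest free spot at or below \<open>b i\<close>. With the choice
  \<open>a = x\<close>, an interval parking function witnessing \<open>reaches n x y\<close> is therefore a \<open>b\<close> lying above
  \<open>x\<close> and \<open>y\<close> such that, for every \<open>i\<close>, the spots in \<open>(y i, b i]\<close> go to cars later than \<open>i\<close>.
  The smallest candidate \<open>b i = max (x i) (y i)\<close> works as soon as there are no \<open>j < i\<close> with
  \<open>y i < y j \<le> x i\<close> (lemma \<open>reachesI\<close>).

  Suppose that \<open>x\<close> is an AR permutation above \<open>y\<close> and that such \<open>j < i\<close> exist. A Bruhat step
  downwards exchanges the values of an inversion (lemma \<open>bruhat_stepE\<close>), hence moves large values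
  to the right and small ones to the left. Two properties survive this: being an AR permutation,
  and mapping an initial segment \<open>{1..m}\<close> to itself. So \<open>y\<close> is an AR permutation, whence
  \<open>y i \<ge> i - 1\<close>, and it is enough to see that \<open>y j \<le> i - 1\<close>. This is clear if \<open>x i < i\<close>, as
  \<open>y j \<le> x i\<close>. Otherwise the AR property forces \<open>x\<close> to map \<open>{1..i - 1}\<close> to itself
  (lemma \<open>AR_initial_segment\<close>), and then so does \<open>y\<close>.
\<close>

section \<open>Parking with a prescribed outcome\<close>

lemma park_eqI:
  assumes "\<And>i. i \<in> {1..m} \<Longrightarrow> a i \<le> w i \<and> w i \<le> b i"
    and "inj_on w {1..m}"
    and "\<And>i v. i \<in> {1..m} \<Longrightarrow> a i \<le> v \<Longrightarrow> v < w i \<Longrightarrow> v \<in> w ` {1..<i}"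
  shows "park a b m = Some (\<lambda>i. if i \<in> {1..m} then w i else i)"
  using assms
proof (induction m)
  case 0
  then show ?case by (auto simp: id_def)
next
  case (Suc m)
  let ?u = "\<lambda>i. if i \<in> {1..m} then w i else i"
  have IH: "park a b m = Some ?u"
  proof (rule Suc.IH)
    show "inj_on w {1..m}"
      using Suc.prems(2) by (rule inj_on_subset) auto
  qed (use Suc.prems(1,3) in auto)
  define free where "free = {a (Suc m)..b (Suc m)} - ?u ` {1..m}"
  have img: "?u ` {1..m} = w ` {1..<Suc m}"
    by (auto simp: image_iff)
  have "w (Suc m) \<notin> w ` {1..<Suc m}"
    using Suc.prems(2) by (force simp: inj_on_def)
  then have mem: "w (Suc m) \<in> free"
    unfolding free_def img using Suc.prems(1)[of "Suc m"] by simp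
  have "Min free = w (Suc m)"
  proof (rule Min_eqI)
    show "finite free" by (simp add: free_def)
    show "w (Suc m) \<in> free" by (rule mem)
    show "w (Suc m) \<le> v" if "v \<in> free" for v
      using that Suc.prems(3)[of "Suc m" v] unfolding free_def img
      by (cases "v < w (Suc m)") auto
  qed
  then have "park a b (Suc m) = Some (?u(Suc m := w (Suc m)))"
    using IH mem by (auto simp: Let_def free_def)
  also have "?u(Suc m := w (Suc m)) = (\<lambda>i. if i \<in> {1..Suc m} then w i else i)"
    by (auto simp: fun_eq_iff)
  finally show ?case .
qed

lemma park_eq_permutation:
  assumes "w permutes {1..n}"
    and "\<And>i. i \<in> {1..n} \<Longrightarrow> a i \<le> w i \<and> w i \<le> b i"
    and "\<And>i v. i \<in> {1..n} \<Longrightarrow> a i \<le> v \<Longrightarrow> v < w i \<Longrightarrow> v \<in> w ` {1..<i}"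
  shows "park a b n = Some w"
proof -
  have "park a b n = Some (\<lambda>i. if i \<in> {1..n} then w i else i)"
    using assms(2,3) permutes_inj_on[OF assms(1)] by (intro park_eqI) auto
  also have "(\<lambda>i. if i \<in> {1..n} then w i else i) = w"
    using permutes_not_in[OF assms(1)] by (auto simp: fun_eq_iff)
  finally show ?thesis .
qed

lemma conjugate_permutes:
  assumes "y permutes {1..n}"
  shows "conjugate n y permutes {1..n}"
proof (rule bij_imp_permutes)
  have *: "y i \<in> {1..n} \<longleftrightarrow> i \<in> {1..n}" for i
    using permutes_in_image[OF assms] .
  have inj: "inj_on (conjugate n y) {1..n}"
  proof (rule inj_onI)
    fix i j assume ij: "i \<in> {1..n}" "j \<in> {1..n}" "conjugate n y i = conjugate n y j"
    then have "n + 1 - i \<in> {1..n}" "n + 1 - j \<in> {1..n}" by auto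
    with * have "y (n + 1 - i) \<in> {1..n}" "y (n + 1 - j) \<in> {1..n}" by blast+
    then have "y (n + 1 - i) = y (n + 1 - j)"
      using ij(1,2) ij(3)[unfolded conjugate_def] by simp arith
    then have "n + 1 - i = n + 1 - j"
      using permutes_inj[OF assms] by (simp add: inj_eq)
    then show "i = j" using ij by auto
  qed
  have "conjugate n y ` {1..n} \<subseteq> {1..n}"
  proof safe
    fix i assume "i \<in> {1..n}"
    moreover from this have "n + 1 - i \<in> {1..n}" by auto
    with * have "y (n + 1 - i) \<in> {1..n}" by blast
    ultimately show "conjugate n y i \<in> {1..n}"
      by (auto simp: conjugate_def)
  qed
  with inj show "bij_betw (conjugate n y) {1..n} {1..n}"
    by (simp add: bij_betw_def endo_inj_surj)
  show "conjugate n y i = i" if "i \<notin> {1..n}" for i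
    using that by (simp only: conjugate_def if_False)
qed

lemma conjugate_conjugate:
  assumes "y permutes {1..n}"
  shows "conjugate n (conjugate n y) = y"
proof
  fix i
  show "conjugate n (conjugate n y) i = y i"
    using permutes_in_image[OF assms, of i] permutes_not_in[OF assms, of i]
    by (auto simp: conjugate_def)
qed

text \<open>
  The hypothesis says that no spot in \<open>(y i, x i]\<close> goes to a car \<open>j < i\<close>. In the backwards
  parking, exactly these cars are still absent when car \<open>i\<close> arrives, so car \<open>i\<close> drives from
  \<open>max (x i) (y i)\<close> past occupied spots only, down to \<open>y i\<close>.
\<close>

lemma reachesI:
  assumes x: "x permutes {1..n}" and y: "y permutes {1..n}"
    and sep: "\<And>i j. 1 \<le> j \<Longrightarrow> j < i \<Longrightarrow> i \<le> n \<Longrightarrow> y i < y j \<Longrightarrow> x i < y j"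
  shows "reaches n x y"
proof -
  define b where "b = (\<lambda>i. max (x i) (y i))"
  have x_in: "x i \<in> {1..n}" and y_in: "y i \<in> {1..n}" if "i \<in> {1..n}" for i
    using that permutes_in_image[OF x] permutes_in_image[OF y] by blast+
  have b_in: "b i \<in> {1..n}" if "i \<in> {1..n}" for i
    using x_in[OF that] y_in[OF that] by (auto simp: b_def max_def)
  have "park x b n = Some x"
    by (rule park_eq_permutation[OF x]) (auto simp: b_def)
  then have ipf: "interval_parking_function n x b"
    unfolding interval_parking_function_def using x_in b_in by (auto simp: b_def)
  have "park x (\<lambda>_. n) n = Some x"
    by (rule park_eq_permutation[OF x]) (use x_in in auto)
  then have out_x: "outcome n x = Some x"
    using x_in by (auto simp: outcome_def)
  have "park (conjugate n b) (\<lambda>_. n) n = Some (conjugate n y)"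
  proof (rule park_eq_permutation[OF conjugate_permutes[OF y]])
    fix i assume i: "i \<in> {1..n}"
    then have i': "n + 1 - i \<in> {1..n}" by auto
    show "conjugate n b i \<le> conjugate n y i \<and> conjugate n y i \<le> n"
      using i y_in[OF i'] by (auto simp: conjugate_def b_def)
    fix v assume v: "conjugate n b i \<le> v" "v < conjugate n y i"
    define u where "u = n + 1 - v"
    have v_in: "v \<in> {1..n}"
      using v i y_in[OF i'] b_in[OF i'] by (auto simp: conjugate_def)
    then have "u \<in> y ` {1..n}"
      unfolding permutes_image[OF y] u_def by auto
    then obtain j where j: "j \<in> {1..n}" "u = y j" by blast
    have yu: "y (n + 1 - i) < u" and ub: "u \<le> b (n + 1 - i)"
      using v i v_in y_in[OF i'] b_in[OF i'] by (auto simp: conjugate_def u_def)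
    have "j > n + 1 - i"
    proof (rule ccontr)
      assume "\<not> j > n + 1 - i"
      then have "j < n + 1 - i" using yu j(2) by (cases "j = n + 1 - i") auto
      then have "x (n + 1 - i) < y j"
        using sep[of j "n + 1 - i"] j yu i' by auto
      then show False using yu ub j(2) by (auto simp: b_def)
    qed
    then have "n + 1 - j \<in> {1..<i}" using j(1) i by auto
    moreover have "v = conjugate n y (n + 1 - j)"
      using j v_in by (auto simp: conjugate_def u_def)
    ultimately show "v \<in> conjugate n y ` {1..<i}" by blast
  qed
  moreover have "conjugate n b \<in> {1..n} \<rightarrow> {1..n}"
  proof
    fix i assume "i \<in> {1..n}"
    moreover from this have "n + 1 - i \<in> {1..n}" by auto
    note b_in[OF this]
    ultimately show "conjugate n b i \<in> {1..n}"
      by (auto simp: conjugate_def)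
  qed
  ultimately have "outcome n (conjugate n b) = Some (conjugate n y)"
    by (auto simp: outcome_def)
  then have "map_option (conjugate n) (outcome n (conjugate n b)) = Some y"
    by (simp add: conjugate_conjugate[OF y])
  with ipf out_x show ?thesis unfolding reaches_def by blast
qed

section \<open>Bruhat steps\<close>

text \<open>
  Inversions of \<open>x\<close> inject into those of \<open>x \<circ> transpose p q\<close>: an inversion is carried along by
  the transposition if this keeps its two positions in order, and otherwise stays put. The map is
  an involution on the pairs \<open>a < b\<close>, hence injective.
\<close>

lemma perm_length_transpose_ge:
  assumes "p \<in> {1..n}" "q \<in> {1..n}" "p < q" "x p < x q"
  shows "perm_length n x \<le> perm_length n (x \<circ> transpose p q)"
proof -
  define s where "s = transpose p q"
  define f where "f = (\<lambda>(a, b). if s a < s b then (s a, s b) else (a, b))"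
  let ?inv = "\<lambda>z::nat \<Rightarrow> nat. {(i, j). i \<in> {1..n} \<and> j \<in> {1..n} \<and> i < j \<and> z i > z j}"
  have ss: "s (s k) = k" for k by (simp add: s_def)
  have s_in: "s k \<in> {1..n}" if "k \<in> {1..n}" for k
    using assms(1,2) that by (auto simp: s_def transpose_def)
  have "card (?inv x) \<le> card (?inv (x \<circ> s))"
  proof (rule card_inj_on_le)
    have ff: "f (f c) = c" if "c \<in> ?inv x" for c
      using that by (auto simp: f_def ss)
    show "inj_on f (?inv x)"
      by (rule inj_on_inverseI[where g = f]) (rule ff)
    show "f ` ?inv x \<subseteq> ?inv (x \<circ> s)"
    proof safe
      fix a b a' b' assume ab: "a \<in> {1..n}" "b \<in> {1..n}" "a < b" "x b < x a"
        and f: "(a', b') = f (a, b)"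
      show "a' \<in> {1..n}" "b' \<in> {1..n}" "a' < b'"
        using f ab s_in by (auto simp: f_def split: if_splits)
      show "(x \<circ> s) b' < (x \<circ> s) a'"
      proof (cases "s a < s b")
        case True
        then show ?thesis using f ab by (simp add: f_def ss)
      next
        case False
        \<comment> \<open>The order of \<open>a < b\<close> is reversed, so \<open>p \<le> a\<close>, \<open>b \<le> q\<close>, and \<open>a = p\<close> or \<open>b = q\<close>.
           The pair \<open>(p, q)\<close> itself is no inversion of \<open>x\<close>. Otherwise the value at \<open>p\<close> grows or
           the value at \<open>q\<close> shrinks, and the inversion persists.\<close>
        have "x (s b) < x (s a)"
          using False ab assms(3,4) by (auto simp: s_def transpose_def split: if_splits)
        then show ?thesis using f False by (simp add: f_def)
      qed
    qed
    show "finite (?inv (x \<circ> s))"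
      by (rule finite_subset[of _ "{1..n} \<times> {1..n}"]) auto
  qed
  then show ?thesis unfolding perm_length_def s_def .
qed

lemma bruhat_stepE:
  assumes "x permutes {1..n}" and "bruhat_step n x y"
  obtains p q where "p \<in> {1..n}" "q \<in> {1..n}" "p < q" "x q < x p" "y = x \<circ> transpose p q"
proof -
  from assms(2) obtain i j where ij: "i \<in> {1..n}" "j \<in> {1..n}" "y = transpose i j \<circ> x"
    and len: "perm_length n y < perm_length n x"
    unfolding bruhat_step_def by blast
  define p q where "p = min (inv x i) (inv x j)" and "q = max (inv x i) (inv x j)"
  have inv_in: "inv x i \<in> {1..n}" "inv x j \<in> {1..n}"
    using ij permutes_in_image[OF permutes_inv[OF assms(1)]] by blast+
  have pq: "p \<in> {1..n}" "q \<in> {1..n}"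
    using inv_in by (auto simp: p_def q_def min_def max_def)
  have "y = x \<circ> transpose (inv x i) (inv x j)"
    using transpose_comp_eq[OF permutes_bij[OF assms(1)], of i j]
      ij(3) by simp
  also have "transpose (inv x i) (inv x j) = transpose p q"
    by (auto simp: p_def q_def min_def max_def transpose_commute)
  finally have y: "y = x \<circ> transpose p q" .
  have "p \<noteq> q" using y len by auto
  then have "p < q" by (auto simp: p_def q_def)
  have "x p \<noteq> x q"
    using \<open>p \<noteq> q\<close> permutes_inj[OF assms(1)] by (simp add: inj_eq)
  moreover have "\<not> x p < x q"
    using perm_length_transpose_ge[OF pq \<open>p < q\<close>, of x] len y by auto
  ultimately have "x q < x p" by auto
  then show thesis using that pq \<open>p < q\<close> y by blast
qed

lemma AR_permutation_bound:
  assumes "AR_permutation n x" "i \<in> {1..n}"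
  shows "i \<le> x i + 1"
  using assms permutes_in_image[of x "{1..n}" i] permutes_inverses(2)[of x "{1..n}" i]
  unfolding AR_permutation_def by metis

lemma AR_permutationI:
  assumes "x permutes {1..n}" "\<And>i. i \<in> {1..n} \<Longrightarrow> i \<le> x i + 1"
  shows "AR_permutation n x"
  unfolding AR_permutation_def
proof (intro conjI ballI)
  fix v assume "v \<in> {1..n}"
  then have "inv x v \<in> {1..n}"
    using permutes_in_image[OF permutes_inv[OF assms(1)]] by blast
  then show "inv x v \<le> v + 1"
    using assms(2) permutes_inverses(1)[OF assms(1)] by metis
qed (rule assms(1))

lemma AR_bruhat_step:
  assumes "AR_permutation n x" "bruhat_step n x y"
  shows "AR_permutation n y"
proof -
  have x: "x permutes {1..n}" using assms(1) by (simp add: AR_permutation_def)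
  obtain p q where pq: "p \<in> {1..n}" "q \<in> {1..n}" "p < q" "x q < x p" "y = x \<circ> transpose p q"
    using bruhat_stepE[OF x assms(2)] .
  show ?thesis
  proof (rule AR_permutationI)
    show "y permutes {1..n}"
      unfolding pq(5) by (rule permutes_compose[OF permutes_swap_id[OF pq(1,2)] x])
    fix i assume "i \<in> {1..n}"
    then show "i \<le> y i + 1"
      using AR_permutation_bound[OF assms(1), of i] AR_permutation_bound[OF assms(1), of q] pq
      by (auto simp: transpose_def)
  qed
qed

lemma bruhat_step_initial_segment:
  assumes "x permutes {1..n}" "bruhat_step n x y" "x ` {1..m} \<subseteq> {1..m}"
  shows "y ` {1..m} \<subseteq> {1..m}"
proof -
  obtain p q where pq: "p \<in> {1..n}" "q \<in> {1..n}" "p < q" "x q < x p" "y = x \<circ> transpose p q"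
    using bruhat_stepE[OF assms(1,2)] .
  have "x q \<ge> 1" using permutes_in_image[OF assms(1), of q] pq by auto
  show ?thesis
  proof (rule image_subsetI)
    fix k assume k: "k \<in> {1..m}"
    have "p \<in> {1..m} \<Longrightarrow> x p \<le> m" "x k \<in> {1..m}"
      using assms(3) k by (auto simp: image_subset_iff)
    moreover have "p \<in> {1..m}" if "k = p \<or> k = q"
      using that k pq(1,3) by auto
    ultimately show "y k \<in> {1..m}"
      using \<open>x q \<ge> 1\<close> pq(4,5) by (auto simp: transpose_def)
  qed
qed

lemma AR_bruhat_ge:
  assumes "bruhat_ge n x y" "AR_permutation n x"
  shows "AR_permutation n y"
  using assms unfolding bruhat_ge_def
  by (induction rule: rtranclp_induct) (auto intro: AR_bruhat_step)

lemma bruhat_ge_initial_segment: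
  assumes "bruhat_ge n x y" "AR_permutation n x" "x ` {1..m} \<subseteq> {1..m}"
  shows "y ` {1..m} \<subseteq> {1..m}"
  using assms unfolding bruhat_ge_def
proof (induction rule: rtranclp_induct)
  case (step y z)
  then have "y permutes {1..n}"
    using AR_bruhat_ge[of n x y] by (simp add: bruhat_ge_def AR_permutation_def)
  with step show ?case by (blast dest: bruhat_step_initial_segment)
qed

section \<open>AR permutations\<close>

text \<open>
  The values \<open>v \<le> i - 2\<close> of an AR permutation sit at positions at most \<open>v + 1 \<le> i - 1\<close>, and the
  value \<open>i - 1\<close> sits at a position at most \<open>i\<close>, but not at \<open>i\<close> itself when \<open>i \<le> x i\<close>. So the
  positions \<open>1, \<dots>, i - 1\<close> are filled up by the values \<open>1, \<dots>, i - 1\<close>.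
\<close>

lemma AR_initial_segment:
  assumes "AR_permutation n x" "i \<in> {1..n}" "i \<le> x i"
  shows "x ` {1..i - 1} \<subseteq> {1..i - 1}"
proof -
  have x: "x permutes {1..n}" using assms(1) by (simp add: AR_permutation_def)
  have "inv x v \<in> {1..i - 1}" if "v \<in> {1..i - 1}" for v
  proof -
    have v: "v \<in> {1..n}" using that assms(2) by auto
    then have in_n: "inv x v \<in> {1..n}"
      using permutes_in_image[OF permutes_inv[OF x]] by blast
    have "inv x v \<le> v + 1" using assms(1) v by (simp add: AR_permutation_def)
    moreover have "inv x v \<noteq> i"
    proof
      assume "inv x v = i"
      then have "x i = v" using permutes_inverses(1)[OF x] by blast
      with that assms(3) show False by auto
    qed
    ultimately show ?thesis using that in_n by auto
  qed
  then have "inv x ` {1..i - 1} \<subseteq> {1..i - 1}" by blast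
  then have "inv x ` {1..i - 1} = {1..i - 1}"
    using permutes_inj_on[OF permutes_inv[OF x]] by (simp add: endo_inj_surj)
  then have "x ` {1..i - 1} = (x \<circ> inv x) ` {1..i - 1}"
    by (metis image_comp)
  then show ?thesis by (simp add: permutes_inv_o(1)[OF x])
qed

theorem theorem8p5:
  fixes n :: nat and x y :: "nat \<Rightarrow> nat"
  assumes "n \<ge> 1"
    and "x permutes {1..n}" and "y permutes {1..n}"
    and "bruhat_ge n x y"
    and "AR_permutation n x"
  shows "reaches n x y"
proof (rule reachesI[OF assms(2,3)])
  fix i j assume ij: "1 \<le> j" "j < i" "i \<le> n" "y i < y j"
  then have i: "i \<in> {1..n}" by auto
  show "x i < y j"
  proof (rule ccontr)
    assume "\<not> x i < y j"
    have "y j \<le> i - 1"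
    proof (cases "i \<le> x i")
      case True
      have "y ` {1..i - 1} \<subseteq> {1..i - 1}"
        using bruhat_ge_initial_segment[OF assms(4,5) AR_initial_segment[OF assms(5) i True]] .
      then show ?thesis using ij by (auto simp: image_subset_iff)
    next
      case False
      then show ?thesis using \<open>\<not> x i < y j\<close> by auto
    qed
    moreover have "i \<le> y i + 1"
      using AR_permutation_bound[OF AR_bruhat_ge[OF assms(4,5)] i] .
    ultimately show False using ij by auto
  qed
qed

end
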